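(* Let $(G,\{X_1,\dots,X_k\},B,b)$ be a decomposable \textsc{ExtMinDR} instance and let $e=(t_0,t_1)$ be a useful edge of $G$. For $s\in\{0,1\}$ let $Z_s$ be the connected component of $G-e$ containing $t_s$, let $Y_s$ be the set of those sets $X_i$ with $X_i\subseteq Z_s$, let $V(Y_s)$ be the union of the sets in $Y_s$, and let $B_s$ be the (multiset) intersection of $B$ with $Z_s$. Define the \textsc{ExtMinDR} instance $I_s=(G[Z_s],\ Y_s,\ B_s\cup\{t_s\},\ b_s)$, where the vertex $t_s$ is added to the multiset $B_s$ with weight \[ b_s(t_s)=2|Y_{1-s}|+\sum_{z\in B_{1-s}} b(z), \] and $b_s(z)=b(z)$ for every $z\in B_s$. Let $S$ be an optimal solution of the original instance and, for $s\in\{0,1\}$, let $S_s$ be an optimal solution of $I_s$ (with $f(S_s)$ its cost in instance $I_s$). Then \[ f(S)=f(S_0)+f(S_1)+2|Y_0||Y_1|\,d(t_0,t_1)+\sum_{s\in\{0,1\}}\Bigl(|S\cap V(Y_s)|\cdot\sum_{z\in B\cap Z_{1-s}} b(z)\,d(t_s,z)\Bigr). \]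
   Context: Graphs are undirected and possibly edge-weighted; $d(u,v)$ is the distance between $u$ and $v$ (number of edges of a shortest path, or total weight of a lightest path in the weighted case). For $W\subseteq V$, $G[W]$ is the induced subgraph; $G-e$ is $G$ with edge $e$ removed. An edge $e$ is a bridge if $G-e$ has more connected components than $G$. A connected bridgeless graph is biconnected, and a maximal set of vertices inducing a biconnected subgraph is a biconnected component. \textsc{ExtMinDR}: an instance is $(G,\{X_1,\ldots,X_k\},B,b)$ where $G=(V,E)$ is an undirected (possibly weighted) graph, $X_1,\ldots,X_k\subseteq V$, and $B$ is a multiset of vertices, each element $z\in B$ having a weight $b(z)$. A feasible solution is a multiset $S=\{x_1,\ldots,x_k\}$ of vertices meeting every $X_i$ (here, with $x_i\in X_i$), with cost \[ f(S)=\sum_{i=1}^k\sum_{j=1}^k d(x_i,x_j)+\sum_{i=1}^k\sum_{z\in B} b(z)\,d(x_i,z), \] and an optimal solution is a feasible solution of minimum cost. The instance is decomposable if (i) $G[X_i]$ is connected for every $i$, and (ii) for all $i\neq j$ and all $x\in X_i$, $y\in X_j$, the vertices $x$ and $y$ do not belong to the same biconnected component of $G$ (in particular the $X_i$ are pairwise disjoint). An edge $e=(x,y)$ is useful if it is a bridge, $x$ and $y$ do not belong to the same set $X_i$, and there are at least two indices $i,j$ such that $X_i$ and $X_j$ lie in different connected components of $G-e$. *)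

theory Defs
  imports Complex_Main "HOL-Library.Multiset"
begin

text \<open>Finite simple undirected graphs, an edge being a two-element set of vertices. The unweighted
  case is the weight function that is constantly 1.\<close>

record 'a graph =
  verts :: "'a set"
  edges :: "'a set set"
  weight :: "'a set \<Rightarrow> real"

definition wf_graph :: "'a graph \<Rightarrow> bool" where
  "wf_graph G \<longleftrightarrow> finite (verts G) \<and>
     (\<forall>e\<in>edges G. \<exists>u\<in>verts G. \<exists>v\<in>verts G. u \<noteq> v \<and> e = {u, v})"

definition induce :: "'a graph \<Rightarrow> 'a set \<Rightarrow> 'a graph" where
  "induce G W = \<lparr>verts = verts G \<inter> W, edges = {e \<in> edges G. e \<subseteq> W}, weight = weight G\<rparr>"

definition delete_edge :: "'a graph \<Rightarrow> 'a set \<Rightarrow> 'a graph" where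
  "delete_edge G e = G\<lparr>edges := edges G - {e}\<rparr>"

definition is_path :: "'a graph \<Rightarrow> 'a \<Rightarrow> 'a list \<Rightarrow> 'a \<Rightarrow> bool" where
  "is_path G u p v \<longleftrightarrow> p \<noteq> [] \<and> hd p = u \<and> last p = v \<and> distinct p \<and> set p \<subseteq> verts G \<and>
     successively (\<lambda>x y. {x, y} \<in> edges G) p"

definition path_weight :: "'a graph \<Rightarrow> 'a list \<Rightarrow> real" where
  "path_weight G p = (\<Sum>i<length p - 1. weight G {p ! i, p ! Suc i})"

definition joined :: "'a graph \<Rightarrow> 'a \<Rightarrow> 'a \<Rightarrow> bool" where
  "joined G u v \<longleftrightarrow> (\<exists>p. is_path G u p v)"

text \<open>Paths do not repeat vertices, so in a finite graph the minimum ranges over a finite set. It is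
  only meaningful when the two vertices are joined by a path.\<close>

definition gdist :: "'a graph \<Rightarrow> 'a \<Rightarrow> 'a \<Rightarrow> real" where
  "gdist G u v = Min {path_weight G p | p. is_path G u p v}"

definition connected_graph :: "'a graph \<Rightarrow> bool" where
  "connected_graph G \<longleftrightarrow> (\<forall>u\<in>verts G. \<forall>v\<in>verts G. joined G u v)"

definition component_of :: "'a graph \<Rightarrow> 'a \<Rightarrow> 'a set" where
  "component_of G u = {v \<in> verts G. joined G u v}"

definition components :: "'a graph \<Rightarrow> 'a set set" where
  "components G = component_of G ` verts G"

definition bridge :: "'a graph \<Rightarrow> 'a set \<Rightarrow> bool" where
  "bridge G e \<longleftrightarrow> e \<in> edges G \<and> card (components (delete_edge G e)) > card (components G)"

definition biconnected :: "'a graph \<Rightarrow> bool" where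
  "biconnected G \<longleftrightarrow> connected_graph G \<and> (\<forall>e. \<not> bridge G e)"

definition biconnected_component :: "'a graph \<Rightarrow> 'a set \<Rightarrow> bool" where
  "biconnected_component G C \<longleftrightarrow> C \<subseteq> verts G \<and> biconnected (induce G C) \<and>
     (\<forall>D. C \<subseteq> D \<and> D \<subseteq> verts G \<and> biconnected (induce G D) \<longrightarrow> D = C)"

text \<open>The sets \<open>X\<^sub>1, \<dots>, X\<^sub>k\<close> form a list. The pair \<open>(B, b)\<close> is one multiset of pairs (vertex, weight),
  because two occurrences of a vertex in \<open>B\<close> may carry different weights: this happens in the
  instances \<open>part_instance\<close> below when the added vertex \<open>t\<^sub>s\<close> already belongs to \<open>B\<close>.\<close>

record 'a ext_min_dr =
  graph :: "'a graph"
  parts :: "'a set list"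
  demand :: "('a \<times> real) multiset"

definition terminals :: "'a ext_min_dr \<Rightarrow> 'a set" where
  "terminals \<I> = \<Union> (set (parts \<I>)) \<union> fst ` set_mset (demand \<I>)"

text \<open>The last condition says that all distances occurring in a cost are defined; it holds whenever
  the graph is connected.\<close>

definition ext_min_dr_instance :: "'a ext_min_dr \<Rightarrow> bool" where
  "ext_min_dr_instance \<I> \<longleftrightarrow> wf_graph (graph \<I>) \<and> terminals \<I> \<subseteq> verts (graph \<I>) \<and>
     (\<forall>u\<in>terminals \<I>. \<forall>v\<in>terminals \<I>. joined (graph \<I>) u v)"

definition feasible :: "'a ext_min_dr \<Rightarrow> 'a multiset \<Rightarrow> bool" where
  "feasible \<I> S \<longleftrightarrow> (\<exists>xs. list_all2 (\<in>) xs (parts \<I>) \<and> S = mset xs)"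

definition cost :: "'a ext_min_dr \<Rightarrow> 'a multiset \<Rightarrow> real" where
  "cost \<I> S = (\<Sum>x\<in>#S. \<Sum>y\<in>#S. gdist (graph \<I>) x y) +
     (\<Sum>x\<in>#S. \<Sum>(z, c)\<in>#demand \<I>. c * gdist (graph \<I>) x z)"

definition optimal :: "'a ext_min_dr \<Rightarrow> 'a multiset \<Rightarrow> bool" where
  "optimal \<I> S \<longleftrightarrow> feasible \<I> S \<and> (\<forall>S'. feasible \<I> S' \<longrightarrow> cost \<I> S \<le> cost \<I> S')"

definition decomposable :: "'a ext_min_dr \<Rightarrow> bool" where
  "decomposable \<I> \<longleftrightarrow>
     (\<forall>X\<in>set (parts \<I>). connected_graph (induce (graph \<I>) X)) \<and>
     (\<forall>i<length (parts \<I>). \<forall>j<length (parts \<I>). i \<noteq> j \<longrightarrow>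
        (\<forall>x\<in>parts \<I> ! i. \<forall>y\<in>parts \<I> ! j.
           \<not> (\<exists>C. biconnected_component (graph \<I>) C \<and> x \<in> C \<and> y \<in> C)))"

definition useful :: "'a ext_min_dr \<Rightarrow> 'a \<Rightarrow> 'a \<Rightarrow> bool" where
  "useful \<I> x y \<longleftrightarrow>
     bridge (graph \<I>) {x, y} \<and>
     (\<forall>X\<in>set (parts \<I>). \<not> (x \<in> X \<and> y \<in> X)) \<and>
     (\<exists>i<length (parts \<I>). \<exists>j<length (parts \<I>). i \<noteq> j \<and>
        (\<exists>C\<in>components (delete_edge (graph \<I>) {x, y}).
         \<exists>D\<in>components (delete_edge (graph \<I>) {x, y}).
           C \<noteq> D \<and> parts \<I> ! i \<subseteq> C \<and> parts \<I> ! j \<subseteq> D))"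

text \<open>Below, \<open>side\<close>, \<open>side_parts\<close>, \<open>side_demand\<close> and \<open>part_instance\<close> are \<open>Z\<^sub>s\<close>, \<open>Y\<^sub>s\<close>, \<open>B\<^sub>s\<close>
  (with its weights) and \<open>I\<^sub>s\<close> for the edge between \<open>t 0\<close> and \<open>t 1\<close>; the index \<open>s\<close> is only used with
  the values 0 and 1.\<close>

definition side :: "'a ext_min_dr \<Rightarrow> (nat \<Rightarrow> 'a) \<Rightarrow> nat \<Rightarrow> 'a set" where
  "side \<I> t s = component_of (delete_edge (graph \<I>) {t 0, t 1}) (t s)"

definition side_parts :: "'a ext_min_dr \<Rightarrow> (nat \<Rightarrow> 'a) \<Rightarrow> nat \<Rightarrow> 'a set list" where
  "side_parts \<I> t s = filter (\<lambda>X. X \<subseteq> side \<I> t s) (parts \<I>)"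

definition side_demand :: "'a ext_min_dr \<Rightarrow> (nat \<Rightarrow> 'a) \<Rightarrow> nat \<Rightarrow> ('a \<times> real) multiset" where
  "side_demand \<I> t s = {#(z, c) \<in># demand \<I>. z \<in> side \<I> t s#}"

definition part_instance :: "'a ext_min_dr \<Rightarrow> (nat \<Rightarrow> 'a) \<Rightarrow> nat \<Rightarrow> 'a ext_min_dr" where
  "part_instance \<I> t s =
     \<lparr>graph = induce (graph \<I>) (side \<I> t s),
      parts = side_parts \<I> t s,
      demand = add_mset
        (t s, 2 * real (length (side_parts \<I> t (1 - s))) + (\<Sum>(z, c)\<in>#side_demand \<I> t (1 - s). c))
        (side_demand \<I> t s)\<rparr>"

end

theory Submission
  imports Defs
begin

text \<open>A simple path crosses the bridge \<open>{t\<^sub>0, t\<^sub>1}\<close> at most once, so distances inside \<open>Z\<^sub>s\<close> are those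
  of \<open>G[Z\<^sub>s]\<close>, and \<open>d(x, y) = d(x, t\<^sub>0) + d(t\<^sub>0, t\<^sub>1) + d(t\<^sub>1, y)\<close> for \<open>x \<in> Z\<^sub>0\<close>, \<open>y \<in> Z\<^sub>1\<close>; both hold
  for arbitrary real weights. Every \<open>X\<^sub>i\<close> lies on one side of the bridge, so the feasible solutions
  are the sums of feasible solutions of the two sides, and expanding the cost of such a sum yields
  the two partial costs plus a constant. Hence the minima add up.\<close>

subsection \<open>Paths\<close>

abbreviation adjacency :: "'a graph \<Rightarrow> ('a \<times> 'a) set" where
  "adjacency G \<equiv> {(x, y). {x, y} \<in> edges G}"

lemma is_path_edges_mono:
  assumes "is_path G u p v" and "edges G \<subseteq> edges H" and "verts G \<subseteq> verts H"
  shows "is_path H u p v"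
  using assms unfolding is_path_def by (auto elim: successively_mono)

lemma is_path_induce_iff:
  "is_path (induce G W) u p v \<longleftrightarrow> is_path G u p v \<and> set p \<subseteq> W"
proof -
  have "successively (\<lambda>x y. {x, y} \<in> edges (induce G W)) p \<longleftrightarrow>
      successively (\<lambda>x y. {x, y} \<in> edges G) p" if "set p \<subseteq> W"
    using that by (intro successively_cong) (auto simp: induce_def)
  then show ?thesis
    unfolding is_path_def by (auto simp: induce_def)
qed

lemma is_path_ends: "is_path G u p v \<Longrightarrow> u \<in> set p \<and> v \<in> set p"
  unfolding is_path_def by auto

lemma is_path_rev: "is_path G u p v \<longleftrightarrow> is_path G v (rev p) u"
  unfolding is_path_def by (auto simp: hd_rev last_rev insert_commute)

lemma path_weight_singleton [simp]: "path_weight G [x] = 0"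
  by (simp add: path_weight_def)

lemma path_weight_Cons_Cons [simp]:
  "path_weight G (x # y # p) = weight G {x, y} + path_weight G (y # p)"
  by (simp add: path_weight_def sum.lessThan_Suc_shift del: sum.lessThan_Suc)

lemma path_weight_append:
  "p \<noteq> [] \<Longrightarrow> q \<noteq> [] \<Longrightarrow>
    path_weight G (p @ q) = path_weight G p + weight G {last p, hd q} + path_weight G q"
proof (induction p rule: induct_list012)
  case (2 x)
  then show ?case by (cases q) auto
qed auto

lemma path_weight_rev: "path_weight G (rev p) = path_weight G p"
proof (induction p rule: induct_list012)
  case (3 x y p)
  then show ?case
    using path_weight_append[of "rev (y # p)" "[x]" G]
    by (simp add: last_rev insert_commute)
qed (auto simp: path_weight_def)

lemma path_weight_induce [simp]: "path_weight (induce G W) p = path_weight G p"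
  by (simp add: path_weight_def induce_def)

text \<open>Reversing a path keeps its weight, so both minima range over the same set of
  numbers.\<close>

lemma gdist_commute: "gdist G u v = gdist G v u"
proof -
  have "{path_weight G p | p. is_path G u p v} \<subseteq> {path_weight G p | p. is_path G v p u}" for u v
  proof clarify
    fix p assume "is_path G u p v"
    then have "is_path G v (rev p) u"
      by (rule is_path_rev[THEN iffD1])
    then show "\<exists>q. path_weight G p = path_weight G q \<and> is_path G v q u"
      using path_weight_rev[of G p] by metis
  qed
  then show ?thesis
    unfolding gdist_def by (intro arg_cong[of _ _ Min] subset_antisym)
qed

text \<open>Distinct lists over a finite set are finite in number; this is what makes the
  \<open>Min\<close> in \<open>gdist\<close> usable.\<close>

lemma finite_paths: "finite (verts G) \<Longrightarrow> finite {p. is_path G u p v}"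
  by (rule finite_subset[OF _ finite_subset_distinct[of "verts G"]]) (auto simp: is_path_def)

section \<open>Reachability by simple paths\<close>

lemma joined_prefix:
  assumes "is_path G u p v" and "x \<in> set p"
  shows "joined G u x"
proof -
  obtain q r where p: "p = (q @ [x]) @ r"
    using split_list[OF assms(2)] by auto
  then have "successively (\<lambda>x y. {x, y} \<in> edges G) (q @ [x])"
    using assms(1) successively_append_iff[of _ "q @ [x]" r] by (simp add: is_path_def)
  then have "is_path G u (q @ [x]) x"
    using assms(1) p unfolding is_path_def by (cases q) auto
  then show ?thesis
    unfolding joined_def by blast
qed

text \<open>Since paths may not repeat vertices, appending \<open>w\<close> works only if it is new;
  otherwise the path is cut off at \<open>w\<close>.\<close>

lemma joined_extend:
  assumes "wf_graph G" and "joined G u v" and "{v, w} \<in> edges G"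
  shows "joined G u w"
proof -
  from assms(2) obtain p where p: "is_path G u p v"
    unfolding joined_def by blast
  have w: "w \<in> verts G"
    using assms(1,3) unfolding wf_graph_def by (metis doubleton_eq_iff)
  show ?thesis
  proof (cases "w \<in> set p")
    case True
    then show ?thesis
      using joined_prefix[OF p] by blast
  next
    case False
    then have "is_path G u (p @ [w]) w"
      using p w assms(3) unfolding is_path_def by (auto simp: successively_append_iff)
    then show ?thesis
      unfolding joined_def by blast
  qed
qed

text \<open>Passing to walks removes the distinctness condition, so that transitivity and symmetry
  come for free. The conjunct on \<open>u\<close> is there because the closure is reflexive even
  outside the graph.\<close>

lemma joined_iff_rtrancl:
  assumes "wf_graph G"
  shows "joined G u v \<longleftrightarrow> u \<in> verts G \<and> (u, v) \<in> (adjacency G)\<^sup>*"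
proof
  assume "joined G u v"
  then obtain p where p: "is_path G u p v"
    unfolding joined_def by blast
  have "p \<noteq> [] \<Longrightarrow> successively (\<lambda>x y. {x, y} \<in> edges G) p \<Longrightarrow> (hd p, last p) \<in> (adjacency G)\<^sup>*"
    by (induction p rule: induct_list012) (auto intro: converse_rtrancl_into_rtrancl)
  with p show "u \<in> verts G \<and> (u, v) \<in> (adjacency G)\<^sup>*"
    unfolding is_path_def by (metis hd_in_set subsetD)
next
  assume uv: "u \<in> verts G \<and> (u, v) \<in> (adjacency G)\<^sup>*"
  then have "(u, v) \<in> (adjacency G)\<^sup>*" by blast
  then show "joined G u v"
  proof induction
    case base
    have "is_path G u [u] u"
      using uv by (simp add: is_path_def)
    then show ?case
      unfolding joined_def by blast
  next
    case (step v w)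
    then show ?case
      using joined_extend[OF assms] by blast
  qed
qed

lemma adjacency_rtrancl_sym: "(u, v) \<in> (adjacency G)\<^sup>* \<Longrightarrow> (v, u) \<in> (adjacency G)\<^sup>*"
  by (rule symD[OF sym_rtrancl]) (auto simp: sym_def insert_commute)

lemma component_of_eq:
  assumes "wf_graph G" and "v \<in> component_of G u"
  shows "component_of G v = component_of G u"
  using assms adjacency_rtrancl_sym[of u v G]
  by (auto simp: component_of_def joined_iff_rtrancl[OF assms(1)] intro: rtrancl_trans)

subsection \<open>Distances across a cut edge\<close>

text \<open>This is the situation at a bridge, in a form symmetric in the two sides: no edge but
  \<open>{a, b}\<close> leaves \<open>A\<close> or \<open>B\<close>. The sides need not exhaust the
  vertices, as \<open>G\<close> may have further components.\<close>

locale edge_cut =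
  fixes G :: "'a graph" and A B :: "'a set" and a b :: 'a
  assumes finite_verts: "finite (verts G)"
    and disjoint: "A \<inter> B = {}"
    and a_in: "a \<in> A" and b_in: "b \<in> B"
    and edge: "{a, b} \<in> edges G"
    and leave_A: "{x, y} \<in> edges G \<Longrightarrow> x \<in> A \<Longrightarrow> y \<notin> A \<Longrightarrow> x = a \<and> y = b"
    and leave_B: "{x, y} \<in> edges G \<Longrightarrow> x \<in> B \<Longrightarrow> y \<notin> B \<Longrightarrow> x = b \<and> y = a"
    and connected_A: "u \<in> A \<Longrightarrow> joined (induce G A) u a"
    and connected_B: "u \<in> B \<Longrightarrow> joined (induce G B) u b"
begin

text \<open>Through this symmetry each fact about \<open>A\<close> and \<open>a\<close> is reused
  for \<open>B\<close> and \<open>b\<close>.\<close>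

lemma flip: "edge_cut G B A b a"
proof
  show "B \<inter> A = {}" "{b, a} \<in> edges G"
    using disjoint edge by (auto simp: insert_commute)
qed (fact finite_verts a_in b_in leave_A leave_B connected_A connected_B)+

end

text \<open>The path is cut where it first leaves \<open>A\<close>. That step can only be the one
  from \<open>a\<close> to \<open>b\<close>; nothing is claimed yet about where the rest
  runs.\<close>

lemma (in edge_cut) path_split_first:
  assumes "is_path G u p v" and "u \<in> A" and "\<not> set p \<subseteq> A"
  obtains q r where "p = q @ r" "is_path (induce G A) u q a" "is_path G b r v"
proof -
  define q r where "q = takeWhile (\<lambda>x. x \<in> A) p" and "r = dropWhile (\<lambda>x. x \<in> A) p"
  have pqr: "p = q @ r" by (simp add: q_def r_def)
  have qA: "set q \<subseteq> A" unfolding q_def by (auto dest: set_takeWhileD)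
  have r: "r \<noteq> []" "hd r \<notin> A"
    using assms(3) hd_dropWhile[of "\<lambda>x. x \<in> A" p] by (auto simp: r_def)
  have q: "q \<noteq> []"
    using assms(1,2) by (cases p) (auto simp: q_def is_path_def)
  have "{last q, hd r} \<in> edges G"
    using assms(1) q r unfolding pqr is_path_def by (auto simp: successively_append_iff)
  moreover have "last q \<in> A" using q qA by auto
  ultimately have "last q = a" "hd r = b"
    using leave_A r by blast+
  then have "is_path (induce G A) u q a" "is_path G b r v"
    using assms(1) q r qA unfolding pqr is_path_induce_iff unfolding is_path_def
    by (auto simp: successively_append_iff)
  with pqr that show thesis by blast
qed

context edge_cut
begin

text \<open>After the crossing, leaving \<open>B\<close> would mean returning through
  \<open>a\<close>, which the first piece has already visited; a simple path cannot do that.\<close>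

lemma path_split:
  assumes p: "is_path G u p v" and "u \<in> A" and "\<not> set p \<subseteq> A"
  obtains q r where "p = q @ r" "is_path (induce G A) u q a" "is_path (induce G B) b r v"
proof -
  obtain q r where qr: "p = q @ r" "is_path (induce G A) u q a" "is_path G b r v"
    using path_split_first[OF assms] .
  have "set r \<subseteq> B"
  proof (rule ccontr)
    assume "\<not> set r \<subseteq> B"
    then obtain r1 r2 where "r = r1 @ r2" "is_path G a r2 v"
      using edge_cut.path_split_first[OF flip qr(3) b_in] by metis
    then have "a \<in> set q" "a \<in> set r"
      using is_path_ends qr(2) by (fastforce dest: is_path_ends)+
    then show False
      using p qr(1) by (auto simp: is_path_def)
  qed
  with qr that show thesis by (simp add: is_path_induce_iff)
qed

lemma path_append:
  assumes "is_path (induce G A) u q a" and "is_path (induce G B) b r v"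
  shows "is_path G u (q @ r) v"
  using assms edge disjoint unfolding is_path_induce_iff unfolding is_path_def
  by (auto simp: successively_append_iff)

text \<open>By \<open>path_split\<close>, a path that starts in \<open>A\<close> and leaves it must
  end in \<open>B\<close>.\<close>

lemma path_same_side:
  assumes "u \<in> A" and "v \<in> A"
  shows "is_path (induce G A) u p v \<longleftrightarrow> is_path G u p v"
proof -
  have "set p \<subseteq> A" if p: "is_path G u p v"
  proof (rule ccontr)
    assume "\<not> set p \<subseteq> A"
    then obtain r where "is_path (induce G B) b r v"
      using path_split[OF p assms(1)] by metis
    then have "v \<in> B"
      by (auto simp: is_path_induce_iff dest: is_path_ends)
    then show False
      using assms(2) disjoint by blast
  qed
  then show ?thesis
    by (auto simp: is_path_induce_iff)
qed

lemma gdist_same_side: "u \<in> A \<Longrightarrow> v \<in> A \<Longrightarrow> gdist (induce G A) u v = gdist G u v"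
  by (simp add: gdist_def path_same_side)

lemma paths_across:
  assumes "u \<in> A" and "v \<in> B"
  shows "{p. is_path G u p v} =
    (\<lambda>(q, r). q @ r) ` ({q. is_path G u q a} \<times> {r. is_path G b r v})"
proof -
  have "\<not> set p \<subseteq> A" if "is_path G u p v" for p
    using is_path_ends[OF that] assms(2) disjoint by blast
  then have "is_path G u p v \<longleftrightarrow>
      (\<exists>q r. p = q @ r \<and> is_path (induce G A) u q a \<and> is_path (induce G B) b r v)" for p
    using path_split assms(1) path_append by metis
  \<comment> \<open>Both ends of each piece lie on one side, so paths of the induced graphs may be
    replaced by paths of \<open>G\<close>; the two pieces then range independently.\<close>
  then show ?thesis
    unfolding path_same_side[OF assms(1) a_in] edge_cut.path_same_side[OF flip b_in assms(2)]
    by auto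
qed

text \<open>The paths from \<open>u\<close> to \<open>v\<close> are the pairs of a path to
  \<open>a\<close> and a path from \<open>b\<close>, with additive weight; the minimum of such a sum
  over a product is the sum of the minima.\<close>

lemma gdist_across:
  assumes "u \<in> A" and "v \<in> B"
  shows "gdist G u v = gdist G u a + weight G {a, b} + gdist G b v"
proof -
  let ?P = "{q. is_path G u q a}" and ?Q = "{r. is_path G b r v}"
  have fin: "finite ?P" "finite ?Q"
    using finite_paths[OF finite_verts] by blast+
  have P: "?P \<noteq> {}"
    using connected_A[OF assms(1)] by (auto simp: joined_def path_same_side[OF assms(1) a_in])
  have Q: "?Q \<noteq> {}"
    using connected_B[OF assms(2)] is_path_rev[of G v _ b]
    by (auto simp: joined_def edge_cut.path_same_side[OF flip assms(2) b_in])
  have weight: "path_weight G (q @ r) = path_weight G q + weight G {a, b} + path_weight G r"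
    if "is_path G u q a" "is_path G b r v" for q r
    using that by (subst path_weight_append) (auto simp: is_path_def)
  have gd: "gdist G x y = Min (path_weight G ` {p. is_path G x p y})" for x y
    by (simp add: gdist_def setcompr_eq_image)
  \<comment> \<open>Both path sets are nonempty because each side is connected to its end of the
    edge, so the two minima are attained.\<close>
  have "gdist G u a \<in> path_weight G ` ?P" "gdist G b v \<in> path_weight G ` ?Q"
    unfolding gd using fin P Q by (intro Min_in finite_imageI; simp)+
  then obtain q r where q: "is_path G u q a" "gdist G u a = path_weight G q"
    and r: "is_path G b r v" "gdist G b v = path_weight G r"
    by blast
  show ?thesis
    unfolding gd[of u v] paths_across[OF assms]
  proof (rule Min_eqI)
    show "finite (path_weight G ` (\<lambda>(q, r). q @ r) ` (?P \<times> ?Q))"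
      using fin by auto
  next
    fix y assume "y \<in> path_weight G ` (\<lambda>(q, r). q @ r) ` (?P \<times> ?Q)"
    then obtain q' r' where *: "is_path G u q' a" "is_path G b r' v" "y = path_weight G (q' @ r')"
      by auto
    have "gdist G u a \<le> path_weight G q'" "gdist G b v \<le> path_weight G r'"
      unfolding gd using fin * by (auto intro!: Min_le)
    then show "gdist G u a + weight G {a, b} + gdist G b v \<le> y"
      using * weight by auto
  next
    show "gdist G u a + weight G {a, b} + gdist G b v
        \<in> path_weight G ` (\<lambda>(q, r). q @ r) ` (?P \<times> ?Q)"
      using q r weight[OF q(1) r(1)] by (intro image_eqI[of _ _ "q @ r"]) auto
  qed
qed

text \<open>The only simple path from \<open>u\<close> to itself is \<open>[u]\<close>, so this
  holds whatever the sign of the weights.\<close>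

lemma gdist_self: "u \<in> A \<Longrightarrow> gdist G u u = 0"
proof -
  assume u: "u \<in> A"
  have "u \<in> verts G"
    using connected_A[OF u] unfolding joined_def is_path_def induce_def
    by (metis Int_iff graph.simps(1) hd_in_set subsetD)
  then have "is_path G u p u \<longleftrightarrow> p = [u]" for p
    unfolding is_path_def
    by (cases p) (auto split: if_splits)
  then show ?thesis
    by (simp add: gdist_def)
qed

lemma gdist_ends: "gdist G a b = weight G {a, b}"
  using gdist_across[OF a_in b_in] gdist_self[OF a_in] edge_cut.gdist_self[OF flip b_in] by simp

text \<open>Splitting at \<open>a\<close> alone leaves a second summand that is independent of
  \<open>u\<close>, as the demand sums require.\<close>

lemma gdist_across':
  assumes "u \<in> A" and "v \<in> B"
  shows "gdist G u v = gdist G u a + gdist G a v"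
  using gdist_across[OF assms] gdist_across[OF a_in assms(2)] gdist_self[OF a_in] by simp

text \<open>A path inside \<open>X\<close> between the two sides would use the cut edge and put both
  of its ends into \<open>X\<close>.\<close>

lemma subset_one_side:
  assumes "connected_graph (induce G X)" and "X \<subseteq> verts G" and "X \<subseteq> A \<union> B"
    and "\<not> (a \<in> X \<and> b \<in> X)"
  shows "X \<subseteq> A \<or> X \<subseteq> B"
proof (rule ccontr)
  assume "\<not> (X \<subseteq> A \<or> X \<subseteq> B)"
  then obtain u v where uv: "u \<in> X" "u \<in> A" "v \<in> X" "v \<notin> A"
    using assms(3) by blast
  then obtain p where p: "is_path G u p v" "set p \<subseteq> X"
    using assms(1,2) unfolding connected_graph_def joined_def is_path_induce_iff
    by (force simp: induce_def)
  have "\<not> set p \<subseteq> A"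
    using is_path_ends[OF p(1)] uv by blast
  then obtain q r where "p = q @ r" "is_path (induce G A) u q a" "is_path (induce G B) b r v"
    using path_split[OF p(1) uv(2)] by metis
  then show False
    using p(2) assms(4) by (auto dest!: is_path_ends)
qed

text \<open>No edge leads out of \<open>A \<union> B\<close>, because an edge leaving one side ends
  on the other.\<close>

lemma joined_sides:
  assumes "wf_graph G" and "joined G u v" and "u \<in> A \<union> B"
  shows "v \<in> A \<union> B"
proof -
  have "(u, v) \<in> (adjacency G)\<^sup>*"
    using assms(2) by (simp add: joined_iff_rtrancl[OF assms(1)])
  then show ?thesis
    using assms(3)
  proof induction
    case (step y z)
    then show ?case
      using leave_A[of y z] leave_B[of y z] a_in b_in by blast
  qed
qed

end

section \<open>Bridges as cut edges\<close>

lemma bridge_not_joined: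
  assumes wf: "wf_graph G" and br: "bridge G {a, b}"
  shows "\<not> joined (delete_edge G {a, b}) a b"
proof
  let ?H = "delete_edge G {a, b}"
  have wfH: "wf_graph ?H" and verts: "verts ?H = verts G"
    using wf by (auto simp: wf_graph_def delete_edge_def)
  assume "joined ?H a b"
  then have ab: "(a, b) \<in> (adjacency ?H)\<^sup>*"
    using joined_iff_rtrancl[OF wfH] by blast
  \<comment> \<open>The deleted edge can be replaced by the connection \<open>ab\<close>, in either
    direction. Reachability, and hence the set of components, would then be unchanged, against the
    definition of a bridge.\<close>
  have "adjacency G \<subseteq> (adjacency ?H)\<^sup>*"
  proof clarify
    fix x y assume "{x, y} \<in> edges G"
    then show "(x, y) \<in> (adjacency ?H)\<^sup>*"
      using ab adjacency_rtrancl_sym[OF ab]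
      by (cases "{x, y} = {a, b}") (auto simp: delete_edge_def doubleton_eq_iff)
  qed
  moreover have "adjacency ?H \<subseteq> adjacency G"
    by (auto simp: delete_edge_def)
  ultimately have "(adjacency ?H)\<^sup>* = (adjacency G)\<^sup>*"
    by (rule rtrancl_subset[symmetric, rotated])
  then have "joined ?H = joined G"
    by (intro ext) (simp add: joined_iff_rtrancl[OF wf] joined_iff_rtrancl[OF wfH] verts)
  then have "components ?H = components G"
    by (simp add: components_def component_of_def verts)
  with br show False
    by (simp add: bridge_def)
qed

lemma bridge_edge_cut:
  assumes wf: "wf_graph G" and br: "bridge G {a, b}"
  defines "H \<equiv> delete_edge G {a, b}"
  shows "edge_cut G (component_of H a) (component_of H b) a b"
proof -
  have wfH: "wf_graph H" and verts: "verts H = verts G"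
    using wf by (auto simp: wf_graph_def delete_edge_def H_def)
  have ab: "{a, b} \<in> edges G" "a \<in> verts G" "b \<in> verts G"
    using br wf by (auto simp: bridge_def wf_graph_def doubleton_eq_iff)
  have joined: "joined H u v \<longleftrightarrow> u \<in> verts G \<and> (u, v) \<in> (adjacency H)\<^sup>*" for u v
    using joined_iff_rtrancl[OF wfH] verts by simp
  have disj: "component_of H a \<inter> component_of H b = {}"
  proof (rule ccontr)
    assume "component_of H a \<inter> component_of H b \<noteq> {}"
    then obtain x where x: "x \<in> component_of H a" "x \<in> component_of H b"
      by blast
    have "component_of H a = component_of H b"
      using component_of_eq[OF wfH x(1)] component_of_eq[OF wfH x(2)] by simp
    moreover have "b \<in> component_of H b"
      using ab by (simp add: component_of_def joined verts)
    ultimately show False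
      using bridge_not_joined[OF wf br] by (auto simp: component_of_def H_def)
  qed
  \<comment> \<open>Any other edge survives the deletion and would draw \<open>y\<close> into the
    component of \<open>x\<close>.\<close>
  have leave: "{x, y} = {a, b}"
    if "{x, y} \<in> edges G" "x \<in> component_of H c" "y \<notin> component_of H c" for x y c
  proof (rule ccontr)
    assume "{x, y} \<noteq> {a, b}"
    then have "{x, y} \<in> edges H"
      using that by (simp add: H_def delete_edge_def)
    moreover have "y \<in> verts H"
      using that wf verts by (auto simp: wf_graph_def doubleton_eq_iff)
    ultimately have "y \<in> component_of H c"
      using that joined_extend[OF wfH] by (auto simp: component_of_def)
    with that show False by blast
  qed
  have self: "a \<in> component_of H a" "b \<in> component_of H b"
    using ab by (auto simp: component_of_def joined verts)
  have conn: "joined (induce G (component_of H c)) u c" if u: "u \<in> component_of H c" for u c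
  proof -
    have "joined H u c"
      using u by (auto simp: component_of_def joined verts intro: adjacency_rtrancl_sym)
    then obtain p where p: "is_path H u p c"
      by (auto simp: joined_def)
    have "set p \<subseteq> component_of H c"
    proof
      fix x assume x: "x \<in> set p"
      then have "x \<in> component_of H u"
        using p joined_prefix[OF p] by (auto simp: component_of_def is_path_def)
      then show "x \<in> component_of H c"
        using component_of_eq[OF wfH u] by simp
    qed
    moreover have "is_path G u p c"
      using p by (rule is_path_edges_mono) (auto simp: H_def delete_edge_def)
    ultimately show ?thesis
      by (auto simp: joined_def is_path_induce_iff)
  qed
  show ?thesis
  proof
    show "finite (verts G)" using wf by (simp add: wf_graph_def)
    show "x = a \<and> y = b"
      if "{x, y} \<in> edges G" "x \<in> component_of H a" "y \<notin> component_of H a" for x y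
      using leave[OF that] that disj self by (auto simp: doubleton_eq_iff)
    show "x = b \<and> y = a"
      if "{x, y} \<in> edges G" "x \<in> component_of H b" "y \<notin> component_of H b" for x y
      using leave[OF that] that disj self by (auto simp: doubleton_eq_iff)
  qed (use disj self ab conn in auto)
qed

text \<open>A walk from \<open>x\<close> either avoids the deleted edge or reaches one of its ends
  before first using it. This serves to place a terminal on one of the two sides of the
  bridge.\<close>

lemma joined_delete_edge:
  fixes a b :: 'a
  assumes wf: "wf_graph G" and "joined G x y"
  defines "H \<equiv> delete_edge G {a, b}"
  shows "y \<in> component_of H x \<or> x \<in> component_of H a \<union> component_of H b"
proof -
  have wfH: "wf_graph H" and verts: "verts H = verts G"
    using wf by (auto simp: wf_graph_def delete_edge_def H_def)
  have x: "x \<in> verts H" and "(x, y) \<in> (adjacency G)\<^sup>*"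
    using assms(2) by (auto simp: joined_iff_rtrancl[OF wf] verts)
  from this(2) have "(x, y) \<in> (adjacency H)\<^sup>* \<or>
      (x, a) \<in> (adjacency H)\<^sup>* \<or> (x, b) \<in> (adjacency H)\<^sup>*"
  proof induction
    case (step y z)
    then show ?case
      by (cases "{y, z} = {a, b}")
        (auto simp: H_def delete_edge_def doubleton_eq_iff intro: rtrancl_into_rtrancl)
  qed blast
  moreover have "u \<in> component_of H x" if "(x, u) \<in> (adjacency H)\<^sup>*" for u
  proof -
    have "joined H x u"
      using that x by (simp add: joined_iff_rtrancl[OF wfH])
    then show ?thesis
      by (auto simp: component_of_def joined_def is_path_def dest: is_path_ends)
  qed
  moreover have "x \<in> component_of H u" if "u \<in> component_of H x" for u
    using that x component_of_eq[OF wfH that]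
    by (auto simp: component_of_def joined_iff_rtrancl[OF wfH])
  ultimately show ?thesis by blast
qed

subsection \<open>Costs and feasible solutions across a cut edge\<close>

lemma sum_mset_cong:
  "(\<And>x. x \<in># M \<Longrightarrow> f x = g x) \<Longrightarrow> (\<Sum>x\<in>#M. f x) = (\<Sum>x\<in>#M. g x)"
  by (metis image_mset_cong)

context edge_cut
begin

text \<open>Each pair crosses the edge once, and the distance of a vertex to its own end of the edge
  is counted once for every partner on the other side.\<close>

lemma sum_gdist_across:
  assumes "set_mset M \<subseteq> A" and "set_mset N \<subseteq> B"
  shows "(\<Sum>x\<in>#M. \<Sum>y\<in>#N. gdist G x y) =
    real (size N) * (\<Sum>x\<in>#M. gdist G x a) + real (size M) * real (size N) * gdist G a b
    + real (size M) * (\<Sum>y\<in>#N. gdist G y b)"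
proof -
  have inner: "(\<Sum>y\<in>#N. gdist G x y) =
      real (size N) * (gdist G x a + gdist G a b) + (\<Sum>y\<in>#N. gdist G y b)" if "x \<in> A" for x
    using assms(2)
    by (induction N)
      (simp_all add: gdist_across[OF that] gdist_ends gdist_commute[of G b] algebra_simps)
  show ?thesis
    using assms(1) by (induction M) (simp_all add: inner algebra_simps)
qed

text \<open>Seen from \<open>A\<close>, the demand beyond the edge acts like its total weight placed
  at \<open>a\<close>, up to a term that depends on \<open>M\<close> only through its size.\<close>

lemma sum_demand_across:
  assumes "set_mset M \<subseteq> A" and "fst ` set_mset D \<subseteq> B"
  shows "(\<Sum>x\<in>#M. \<Sum>(z, c)\<in>#D. c * gdist G x z) =
    (\<Sum>(z, c)\<in>#D. c) * (\<Sum>x\<in>#M. gdist G x a)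
    + real (size M) * (\<Sum>(z, c)\<in>#D. c * gdist G a z)"
proof -
  have inner: "(\<Sum>(z, c)\<in>#D. c * gdist G x z) =
      (\<Sum>(z, c)\<in>#D. c) * gdist G x a + (\<Sum>(z, c)\<in>#D. c * gdist G a z)" if "x \<in> A" for x
    using assms(2)
    by (induction D) (auto simp: gdist_across'[OF that] algebra_simps)
  show ?thesis
    using assms(1) by (induction M) (simp_all add: inner algebra_simps)
qed

text \<open>Distances of the induced graph become distances of \<open>G\<close>, and the
  contribution of the added demand at \<open>a\<close> is isolated for comparison with the cross
  terms.\<close>

lemma cost_side:
  assumes "set_mset M \<subseteq> A" and "fst ` set_mset D \<subseteq> A"
  shows "cost \<lparr>graph = induce G A, parts = Xs, demand = add_mset (a, k) D\<rparr> M =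
    (\<Sum>x\<in>#M. \<Sum>y\<in>#M. gdist G x y) + (\<Sum>x\<in>#M. \<Sum>(z, c)\<in>#D. c * gdist G x z)
    + k * (\<Sum>x\<in>#M. gdist G x a)"
proof -
  have inner: "(\<Sum>y\<in>#M. gdist (induce G A) x y) = (\<Sum>y\<in>#M. gdist G x y)"
    if "x \<in> A" for x
    using assms(1) that by (intro sum_mset_cong gdist_same_side) auto
  have "(\<Sum>x\<in>#M. \<Sum>y\<in>#M. gdist (induce G A) x y) = (\<Sum>x\<in>#M. \<Sum>y\<in>#M. gdist G x y)"
    using assms(1) by (intro sum_mset_cong inner) auto
  moreover have demand: "(\<Sum>(z, c)\<in>#D. c * gdist (induce G A) x z) =
      (\<Sum>(z, c)\<in>#D. c * gdist G x z)" if "x \<in> A" for x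
    using assms(2) that by (intro sum_mset_cong) (auto simp: gdist_same_side)
  have "(\<Sum>x\<in>#M. \<Sum>(z, c)\<in>#add_mset (a, k) D. c * gdist (induce G A) x z) =
      (\<Sum>x\<in>#M. k * gdist G x a + (\<Sum>(z, c)\<in>#D. c * gdist G x z))"
    using assms(1) a_in demand by (intro sum_mset_cong) (auto simp: gdist_same_side)
  ultimately show ?thesis
    by (simp add: cost_def sum_mset.distrib sum_mset_distrib_left)
qed

text \<open>The double sum meets every cross pair in both orders, hence the factors 2. The cross
  terms that depend on individual vertices are absorbed by the added demands; the three remaining
  terms see only the sizes of \<open>M\<close> and \<open>N\<close>.\<close>

lemma cost_union:
  assumes M: "set_mset M \<subseteq> A" and N: "set_mset N \<subseteq> B"
    and D: "fst ` set_mset D \<subseteq> A" and E: "fst ` set_mset E \<subseteq> B"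
  shows "cost \<lparr>graph = G, parts = Xs, demand = D + E\<rparr> (M + N) =
    cost \<lparr>graph = induce G A, parts = Ys,
      demand = add_mset (a, 2 * real (size N) + (\<Sum>(z, c)\<in>#E. c)) D\<rparr> M
    + cost \<lparr>graph = induce G B, parts = Zs,
      demand = add_mset (b, 2 * real (size M) + (\<Sum>(z, c)\<in>#D. c)) E\<rparr> N
    + 2 * real (size M) * real (size N) * gdist G a b
    + real (size M) * (\<Sum>(z, c)\<in>#E. c * gdist G a z)
    + real (size N) * (\<Sum>(z, c)\<in>#D. c * gdist G b z)"
  unfolding cost_side[OF M D] edge_cut.cost_side[OF flip N E]
  by (simp add: cost_def sum_mset.distrib sum_gdist_across[OF M N] sum_demand_across[OF M E]
      edge_cut.sum_gdist_across[OF flip N M] edge_cut.sum_demand_across[OF flip N D]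
      gdist_commute[of G b a] algebra_simps)

end

section \<open>Splitting and merging feasible solutions\<close>

lemma list_all2_filter_side:
  assumes "list_all2 (\<in>) xs Xs" and "\<forall>X\<in>set Xs. X \<subseteq> A \<or> X \<subseteq> B" and "A \<inter> B = {}"
  shows "list_all2 (\<in>) (filter (\<lambda>x. x \<in> A) xs) (filter (\<lambda>X. X \<subseteq> A) Xs)"
  using assms(1,2)
proof induction
  case (Cons x xs X Xs)
  \<comment> \<open>As \<open>X\<close> lies on one side, its chosen vertex decides which; both
    filters therefore keep the same positions.\<close>
  then have "x \<in> A \<longleftrightarrow> X \<subseteq> A"
    using assms(3) by auto
  with Cons show ?case by auto
qed simp

text \<open>The order of \<open>Xs\<close> dictates how \<open>ys\<close> and \<open>zs\<close> are
  interleaved, so the result is described only up to its multiset.\<close>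

lemma list_all2_merge:
  assumes "list_all2 R ys (filter P Xs)" and "list_all2 R zs (filter (\<lambda>X. \<not> P X) Xs)"
  shows "\<exists>xs. list_all2 R xs Xs \<and> mset xs = mset ys + mset zs"
  using assms
proof (induction Xs arbitrary: ys zs)
  case (Cons X Xs)
  show ?case
  proof (cases "P X")
    case True
    then obtain y ys' where ys: "ys = y # ys'" "R y X" "list_all2 R ys' (filter P Xs)"
      using Cons.prems(1) by (auto simp: list_all2_Cons2)
    then obtain xs where "list_all2 R xs Xs" "mset xs = mset ys' + mset zs"
      using Cons.IH Cons.prems(2) True by auto
    with ys show ?thesis
      by (intro exI[of _ "y # xs"]) auto
  next
    case False
    then obtain z zs' where zs: "zs = z # zs'" "R z X" "list_all2 R zs' (filter (\<lambda>X. \<not> P X) Xs)"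
      using Cons.prems(2) by (auto simp: list_all2_Cons2)
    then obtain xs where "list_all2 R xs Xs" "mset xs = mset ys + mset zs'"
      using Cons.IH Cons.prems(1) False by auto
    with zs show ?thesis
      by (intro exI[of _ "z # xs"]) auto
  qed
qed simp

lemma size_feasible: "feasible \<I> S \<Longrightarrow> size S = length (parts \<I>)"
  by (auto simp: feasible_def dest: list_all2_lengthD)

lemma feasible_subset: "feasible \<I> S \<Longrightarrow> set_mset S \<subseteq> \<Union> (set (parts \<I>))"
  by (fastforce simp: feasible_def list_all2_conv_all_nth in_set_conv_nth)

lemma feasible_nonempty: "feasible \<I> S \<Longrightarrow> X \<in> set (parts \<I>) \<Longrightarrow> X \<noteq> {}"
  by (fastforce simp: feasible_def list_all2_conv_all_nth in_set_conv_nth)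

theorem theorem1:
  fixes \<I> :: "'a ext_min_dr" and t :: "nat \<Rightarrow> 'a"
    and S :: "'a multiset" and T :: "nat \<Rightarrow> 'a multiset"
  assumes "ext_min_dr_instance \<I>"
    and "decomposable \<I>"
    and "useful \<I> (t 0) (t 1)"
    and "optimal \<I> S"
    and "\<And>s. s \<in> {0, 1} \<Longrightarrow> optimal (part_instance \<I> t s) (T s)"
  shows "cost \<I> S =
    cost (part_instance \<I> t 0) (T 0) + cost (part_instance \<I> t 1) (T 1)
    + 2 * real (length (side_parts \<I> t 0)) * real (length (side_parts \<I> t 1))
        * gdist (graph \<I>) (t 0) (t 1)
    + (\<Sum>s\<in>{0, 1}. real (size {#x \<in># S. x \<in> \<Union> (set (side_parts \<I> t s))#})
        * (\<Sum>(z, c)\<in>#side_demand \<I> t (1 - s). c * gdist (graph \<I>) (t s) z))"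
proof -
  define G where "G = graph \<I>"
  define H where "H = delete_edge G {t 0, t 1}"
  define A where "A = side \<I> t 0"
  define B where "B = side \<I> t 1"
  have wf: "wf_graph G" and term_verts: "terminals \<I> \<subseteq> verts G"
    and term_joined: "\<And>u v. u \<in> terminals \<I> \<Longrightarrow> v \<in> terminals \<I> \<Longrightarrow> joined G u v"
    using assms(1) by (auto simp: ext_min_dr_instance_def G_def)
  have br: "bridge G {t 0, t 1}"
    and apart: "\<And>X. X \<in> set (parts \<I>) \<Longrightarrow> \<not> (t 0 \<in> X \<and> t 1 \<in> X)"
    using assms(3) by (auto simp: useful_def G_def)
  have AB: "A = component_of H (t 0)" "B = component_of H (t 1)"
    by (simp_all add: A_def B_def side_def H_def G_def)
  interpret edge_cut G A B "t 0" "t 1"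
    unfolding AB H_def using bridge_edge_cut[OF wf br] .
  have feas: "feasible \<I> S"
    using assms(4) by (simp add: optimal_def)
  \<comment> \<open>An empty set would lie on both sides and be counted twice; the existence of a
    feasible solution excludes it.\<close>
  have nonempty: "X \<noteq> {}" if "X \<in> set (parts \<I>)" for X
    using feasible_nonempty[OF feas that] .

  \<comment> \<open>Usefulness provides two sets in different components of \<open>H\<close>. Their
    vertices are joined in \<open>G\<close>, so the connection uses the bridge and one terminal lies
    in \<open>A \<union> B\<close>; all terminals joined to it follow.\<close>
  have sides: "terminals \<I> \<subseteq> A \<union> B"
  proof -
    have wfH: "wf_graph H"
      using wf by (auto simp: wf_graph_def delete_edge_def H_def)
    obtain X X' C D where X: "X \<in> set (parts \<I>)" "X' \<in> set (parts \<I>)"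
      and CD: "C \<in> components H" "D \<in> components H" "C \<noteq> D" "X \<subseteq> C" "X' \<subseteq> D"
      using assms(3) unfolding useful_def H_def G_def by (meson nth_mem)
    obtain x y where xy: "x \<in> X" "y \<in> X'"
      using X nonempty by blast
    then have x: "x \<in> terminals \<I>" and "joined G x y"
      using X term_joined by (auto simp: terminals_def)
    moreover have "y \<notin> component_of H x"
    proof
      assume y: "y \<in> component_of H x"
      have "C = component_of H x" "D = component_of H y"
        using CD xy component_of_eq[OF wfH] unfolding components_def by blast+
      with y CD(3) component_of_eq[OF wfH] show False by blast
    qed
    ultimately have "x \<in> A \<union> B"
      using joined_delete_edge[OF wf, of x y "t 0" "t 1"] by (auto simp: AB H_def)
    then show ?thesis
      using joined_sides[OF wf term_joined[OF x]] by blast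
  qed
  have one_side: "X \<subseteq> A \<or> X \<subseteq> B" if X: "X \<in> set (parts \<I>)" for X
  proof (rule subset_one_side)
    show "connected_graph (induce G X)"
      using assms(2) X by (simp add: decomposable_def G_def)
    show "X \<subseteq> verts G" "X \<subseteq> A \<union> B"
      using X term_verts sides by (auto simp: terminals_def)
  qed (rule apart[OF X])
  then have side_iff: "X \<subseteq> B \<longleftrightarrow> \<not> X \<subseteq> A" if "X \<in> set (parts \<I>)" for X
    using that nonempty[OF that] disjoint by blast
  have parts: "side_parts \<I> t 0 = filter (\<lambda>X. X \<subseteq> A) (parts \<I>)"
    "side_parts \<I> t 1 = filter (\<lambda>X. X \<subseteq> B) (parts \<I>)"
    by (simp_all add: side_parts_def A_def B_def)
  have partsB: "side_parts \<I> t 1 = filter (\<lambda>X. \<not> X \<subseteq> A) (parts \<I>)"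
    unfolding parts using side_iff by (auto cong: filter_cong)

  define D where "D = side_demand \<I> t 0"
  define E where "E = side_demand \<I> t 1"
  have D: "fst ` set_mset D \<subseteq> A" and E: "fst ` set_mset E \<subseteq> B"
    by (auto simp: D_def E_def side_demand_def A_def B_def)
  \<comment> \<open>Demand vertices are terminals, so outside \<open>A\<close> means inside
    \<open>B\<close>, and \<open>D\<close> and \<open>E\<close> partition the demand.\<close>
  have "E = {#p \<in># demand \<I>. \<not> fst p \<in> A#}"
    unfolding E_def side_demand_def B_def[symmetric]
    using sides disjoint by (intro filter_mset_cong) (auto simp: terminals_def)
  moreover have "D = {#p \<in># demand \<I>. fst p \<in> A#}"
    unfolding D_def side_demand_def A_def by (intro filter_mset_cong) auto
  ultimately have demand: "demand \<I> = D + E"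
    using multiset_partition by metis
  define m where "m = length (side_parts \<I> t 0)"
  define n where "n = length (side_parts \<I> t 1)"
  \<comment> \<open>Every feasible solution of a side has one vertex per set, so its size is
    \<open>m\<close> or \<open>n\<close>; hence \<open>K\<close> does not depend on the solutions
    chosen.\<close>
  define K where "K = 2 * real m * real n * gdist G (t 0) (t 1)
    + real m * (\<Sum>(z, c)\<in>#E. c * gdist G (t 0) z) + real n * (\<Sum>(z, c)\<in>#D. c * gdist G (t 1) z)"
  have feasible_side: "set_mset M \<subseteq> A" "size M = m"
    if "feasible (part_instance \<I> t 0) M" for M
    using feasible_subset[OF that] size_feasible[OF that]
    by (auto simp: part_instance_def m_def parts)
  have feasible_side': "set_mset N \<subseteq> B" "size N = n"
    if "feasible (part_instance \<I> t 1) N" for N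
    using feasible_subset[OF that] size_feasible[OF that]
    by (auto simp: part_instance_def n_def parts simp del: One_nat_def)
  have \<I>: "\<I> = \<lparr>graph = G, parts = parts \<I>, demand = D + E\<rparr>"
    by (simp add: G_def flip: demand)
  have split_cost: "cost \<I> (M + N) =
      cost (part_instance \<I> t 0) M + cost (part_instance \<I> t 1) N + K"
    if "feasible (part_instance \<I> t 0) M" "feasible (part_instance \<I> t 1) N" for M N
    using cost_union[OF feasible_side(1)[OF that(1)] feasible_side'(1)[OF that(2)] D E,
        of "parts \<I>" "side_parts \<I> t 0" "side_parts \<I> t 1"]
    unfolding \<I>[symmetric] feasible_side(2)[OF that(1)] feasible_side'(2)[OF that(2)]
    by (simp add: part_instance_def K_def D_def E_def m_def n_def A_def B_def G_def)

  obtain xs where xs: "list_all2 (\<in>) xs (parts \<I>)" "S = mset xs"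
    using feas by (auto simp: feasible_def)
  define M where "M = {#x \<in># S. x \<in> A#}"
  define N where "N = {#x \<in># S. x \<in> B#}"
  have "N = {#x \<in># S. x \<notin> A#}"
    unfolding N_def using feasible_subset[OF feas] sides disjoint
    by (intro filter_mset_cong) (auto simp: terminals_def)
  then have S: "S = M + N"
    unfolding M_def using multiset_partition by blast
  have M: "feasible (part_instance \<I> t 0) M"
    using list_all2_filter_side[OF xs(1) _ disjoint] one_side
    by (auto simp: feasible_def part_instance_def parts M_def xs(2) mset_filter)
  have N: "feasible (part_instance \<I> t 1) N"
    using list_all2_filter_side[OF xs(1), of B A] disjoint one_side
    unfolding feasible_def part_instance_def parts N_def xs(2)
    by (intro exI[of _ "filter (\<lambda>x. x \<in> B) xs"]) (auto simp: mset_filter)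
  have T: "feasible (part_instance \<I> t 0) (T 0)" "feasible (part_instance \<I> t 1) (T 1)"
    using assms(5) by (simp_all add: optimal_def)
  then obtain ys zs where "list_all2 (\<in>) ys (side_parts \<I> t 0)" "T 0 = mset ys"
    "list_all2 (\<in>) zs (side_parts \<I> t 1)" "T 1 = mset zs"
    by (auto simp: feasible_def part_instance_def simp del: One_nat_def)
  then have "feasible \<I> (T 0 + T 1)"
    using list_all2_merge[of "(\<in>)" ys "\<lambda>X. X \<subseteq> A" "parts \<I>" zs]
    unfolding partsB parts(1) feasible_def by metis
  then have "cost \<I> S \<le> cost \<I> (T 0 + T 1)"
    using assms(4) by (simp add: optimal_def)
  moreover have "cost (part_instance \<I> t 0) (T 0) \<le> cost (part_instance \<I> t 0) M"
    "cost (part_instance \<I> t 1) (T 1) \<le> cost (part_instance \<I> t 1) N"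
    using assms(5) M N by (simp_all add: optimal_def)
  \<comment> \<open>The cost of \<open>S\<close> is at most that of \<open>T 0 + T 1\<close>, while
    each half of \<open>S\<close> costs at least as much as the optimum of its side. With the common
    constant \<open>K\<close>, equality is forced.\<close>
  ultimately have main: "cost \<I> S =
      cost (part_instance \<I> t 0) (T 0) + cost (part_instance \<I> t 1) (T 1) + K"
    using split_cost[OF M N] split_cost[OF T] unfolding S by linarith

  \<comment> \<open>The claim counts the vertices of \<open>S\<close> in the sets of a side, whereas
    \<open>M\<close> and \<open>N\<close> collect those on the side itself. These agree, as a vertex
    of \<open>S\<close> belongs to some set and that set does not straddle the bridge.\<close>
  have in_Union: "x \<in> \<Union> (set (filter (\<lambda>X. X \<subseteq> Z) (parts \<I>))) \<longleftrightarrow> x \<in> Z"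
    if x: "x \<in># S" and Z: "Z = A \<or> Z = B" for x Z
  proof -
    obtain X where X: "X \<in> set (parts \<I>)" "x \<in> X"
      using feasible_subset[OF feas] x by blast
    have "x \<in> Z \<Longrightarrow> X \<subseteq> Z"
      using one_side[OF X(1)] X(2) Z disjoint by blast
    with X show ?thesis by auto
  qed
  have "{#x \<in># S. x \<in> \<Union> (set (side_parts \<I> t 0))#} = M"
    unfolding M_def parts by (intro filter_mset_cong refl in_Union) simp_all
  moreover have "{#x \<in># S. x \<in> \<Union> (set (side_parts \<I> t 1))#} = N"
    unfolding N_def parts by (intro filter_mset_cong refl in_Union) simp_all
  ultimately show ?thesis
    using main feasible_side(2)[OF M] feasible_side'(2)[OF N]
    by (simp add: K_def m_def n_def D_def E_def G_def)
qed

end
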